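(* Let $G$ be a finite simple graph, let $T$ be a clique in $G$, and let $z$ be a vertex of $T$ with $\deg(z)=|T|-1$. Then $z$ is either a critical vertex or an uncritical vertex, and $Z(G\setminus z)\in\{Z(G),Z(G)-1\}$.
   Context: Zero forcing rule: a filled vertex $v$ forces an unfilled vertex $u$ if $u$ is the only unfilled neighbor of $v$; each vertex forces at most once. A zero forcing set is an initially filled set from which repeated forcing fills all vertices; $Z(G)$ is the minimum size of a zero forcing set, and such a set of minimum size is optimal. An optimal forcing sequence is a sequence of valid forces from an optimal zero forcing set after which no further forces are possible. A forcing sequence yields forcing chains: maximal sequences $(v_0,\dots,v_\ell)$ with each $v_{i-1}\to v_i$ a force of the sequence; for $\ell\ge1$, $v_0$ is the source and $v_\ell$ the terminal vertex (chains of length $0$ have neither). A vertex is critical if there is some optimal forcing sequence in which it neither forces nor gets forced; it is uncritical if for every optimal forcing sequence it is the source or the terminal vertex of its chain. $G\setminus z$ is $G$ with $z$ deleted. *)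

theory Defs
  imports "Graph_Theory.Digraph" "HOL-Library.Sublist"
begin

text \<open>
  A finite simple graph is a \<open>graph\<close> of Graph\_Theory: a finite, loop-free, symmetric digraph
  without parallel arcs. Each undirected edge is a pair of opposite arcs, so the degree of a
  vertex is its \<open>out_degree\<close>.
\<close>

definition clique :: "('a, 'b) pre_digraph \<Rightarrow> 'a set \<Rightarrow> bool" where
  "clique G T \<longleftrightarrow> T \<subseteq> verts G \<and> (\<forall>u\<in>T. \<forall>v\<in>T. u \<noteq> v \<longrightarrow> u \<rightarrow>\<^bsub>G\<^esub> v)"

definition forces :: "('a, 'b) pre_digraph \<Rightarrow> 'a set \<Rightarrow> 'a \<Rightarrow> 'a \<Rightarrow> bool" where
  "forces G F v u \<longleftrightarrow> v \<in> F \<and> {w. v \<rightarrow>\<^bsub>G\<^esub> w \<and> w \<notin> F} = {u}"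

text \<open>
  The pair \<open>(v, u)\<close> in the list records the force \<open>v \<rightarrow> u\<close>; the set is the currently filled set.
  That each vertex forces at most once is a consequence, see \<open>forcing_seq_forces_once\<close>.
\<close>

fun forcing_seq :: "('a, 'b) pre_digraph \<Rightarrow> 'a set \<Rightarrow> ('a \<times> 'a) list \<Rightarrow> bool" where
  "forcing_seq G F [] \<longleftrightarrow> True"
| "forcing_seq G F ((v, u) # fs) \<longleftrightarrow> forces G F v u \<and> forcing_seq G (insert u F) fs"

definition filled_after :: "'a set \<Rightarrow> ('a \<times> 'a) list \<Rightarrow> 'a set" where
  "filled_after B fs = B \<union> snd ` set fs"

definition zero_forcing_set :: "('a, 'b) pre_digraph \<Rightarrow> 'a set \<Rightarrow> bool" where
  "zero_forcing_set G B \<longleftrightarrow>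
     B \<subseteq> verts G \<and> (\<exists>fs. forcing_seq G B fs \<and> filled_after B fs = verts G)"

definition zero_forcing_number :: "('a, 'b) pre_digraph \<Rightarrow> nat" where
  "zero_forcing_number G = (LEAST k. \<exists>B. zero_forcing_set G B \<and> card B = k)"

definition optimal_zero_forcing_set :: "('a, 'b) pre_digraph \<Rightarrow> 'a set \<Rightarrow> bool" where
  "optimal_zero_forcing_set G B \<longleftrightarrow>
     zero_forcing_set G B \<and> card B = zero_forcing_number G"

definition optimal_forcing_seq ::
    "('a, 'b) pre_digraph \<Rightarrow> 'a set \<Rightarrow> ('a \<times> 'a) list \<Rightarrow> bool" where
  "optimal_forcing_seq G B fs \<longleftrightarrow>
     optimal_zero_forcing_set G B \<and> forcing_seq G B fs \<and>
     (\<nexists>v u. forces G (filled_after B fs) v u)"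

definition force_path ::
    "('a, 'b) pre_digraph \<Rightarrow> ('a \<times> 'a) list \<Rightarrow> 'a list \<Rightarrow> bool" where
  "force_path G fs p \<longleftrightarrow>
     p \<noteq> [] \<and> set p \<subseteq> verts G \<and> successively (\<lambda>x y. (x, y) \<in> set fs) p"

text \<open>
  \<open>sublist\<close> means contiguous sublist. A chain \<open>(v\<^sub>0, \<dots>, v\<^sub>l)\<close> is a list with \<open>l + 1\<close> entries, so
  the chains of length \<open>l \<ge> 1\<close> are the lists with at least two entries.
\<close>

definition forcing_chain ::
    "('a, 'b) pre_digraph \<Rightarrow> ('a \<times> 'a) list \<Rightarrow> 'a list \<Rightarrow> bool" where
  "forcing_chain G fs p \<longleftrightarrow>
     force_path G fs p \<and> (\<forall>q. force_path G fs q \<and> sublist p q \<longrightarrow> q = p)"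

definition source_vertex :: "('a, 'b) pre_digraph \<Rightarrow> ('a \<times> 'a) list \<Rightarrow> 'a \<Rightarrow> bool" where
  "source_vertex G fs v \<longleftrightarrow> (\<exists>p. forcing_chain G fs p \<and> length p \<ge> 2 \<and> hd p = v)"

definition terminal_vertex :: "('a, 'b) pre_digraph \<Rightarrow> ('a \<times> 'a) list \<Rightarrow> 'a \<Rightarrow> bool" where
  "terminal_vertex G fs v \<longleftrightarrow> (\<exists>p. forcing_chain G fs p \<and> length p \<ge> 2 \<and> last p = v)"

definition critical_vertex :: "('a, 'b) pre_digraph \<Rightarrow> 'a \<Rightarrow> bool" where
  "critical_vertex G z \<longleftrightarrow> z \<in> verts G \<and>
     (\<exists>B fs. optimal_forcing_seq G B fs \<and> z \<notin> fst ` set fs \<and> z \<notin> snd ` set fs)"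

definition uncritical_vertex :: "('a, 'b) pre_digraph \<Rightarrow> 'a \<Rightarrow> bool" where
  "uncritical_vertex G z \<longleftrightarrow> z \<in> verts G \<and>
     (\<forall>B fs. optimal_forcing_seq G B fs \<longrightarrow> source_vertex G fs z \<or> terminal_vertex G fs z)"

lemma forcing_seq_exhausted:
  assumes "forcing_seq G F fs" "v \<in> F" "{w. v \<rightarrow>\<^bsub>G\<^esub> w} \<subseteq> F"
  shows "v \<notin> fst ` set fs"
  using assms
proof (induction G F fs rule: forcing_seq.induct)
  case (2 G F x u fs)
  then have "x \<noteq> v" by (auto simp: forces_def)
  moreover have "v \<notin> fst ` set fs" using 2 by auto
  ultimately show ?case by auto
qed simp

lemma forcing_seq_forces_once:
  "forcing_seq G F fs \<Longrightarrow> distinct (map fst fs)"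
proof (induction G F fs rule: forcing_seq.induct)
  case (2 G F v u fs)
  have "v \<notin> fst ` set fs"
    by (rule forcing_seq_exhausted[of G "insert u F"]) (use 2 in \<open>auto simp: forces_def\<close>)
  then show ?case using 2 by simp
qed simp

lemma not_critical_and_uncritical:
  "\<not> (critical_vertex G z \<and> uncritical_vertex G z)"
proof
  assume *: "critical_vertex G z \<and> uncritical_vertex G z"
  then obtain B fs where o: "optimal_forcing_seq G B fs"
    and n: "z \<notin> fst ` set fs" "z \<notin> snd ` set fs"
    by (auto simp: critical_vertex_def)
  have "source_vertex G fs z \<or> terminal_vertex G fs z"
    using * o by (auto simp: uncritical_vertex_def)
  then obtain p where p: "successively (\<lambda>x y. (x, y) \<in> set fs) p" "length p \<ge> 2"
    "hd p = z \<or> last p = z"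
    by (auto simp: source_vertex_def terminal_vertex_def forcing_chain_def force_path_def)
  from p(3) show False
  proof
    assume "hd p = z"
    with p(1,2) have "z \<in> fst ` set fs"
      by (cases p rule: remdups_adj.cases) force+
    with n show False by simp
  next
    assume "last p = z"
    with p(1,2) have "z \<in> snd ` set fs"
      by (cases "rev p" rule: remdups_adj.cases)
         (force simp: rev_swap successively_append_iff)+
    with n show False by simp
  qed
qed

lemma zero_forcing_set_verts: "zero_forcing_set G (verts G)"
  unfolding zero_forcing_set_def filled_after_def by (intro conjI exI[of _ "[]"]) auto

end

theory Submission
  imports Defs
begin

text \<open>
  The neighbourhood of \<open>z\<close> is the clique \<open>T - {z}\<close>, so any vertex forcing \<open>z\<close> sees all other
  neighbours of \<open>z\<close>, which are hence already filled: a forced \<open>z\<close> never forces. Thus in every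
  optimal forcing sequence \<open>z\<close> is passive, a source or a terminal vertex. If \<open>z\<close> is filled
  initially and forces \<open>u\<close>, replacing \<open>z\<close> by \<open>u\<close> in the zero forcing set yields one for
  \<open>G \ z\<close>; otherwise the set without \<open>z\<close> works. Conversely, adding \<open>z\<close> to a zero forcing set
  of \<open>G \ z\<close> gives one of \<open>G\<close>.
\<close>

section \<open>Forcing sequences and chains\<close>

lemma forcing_seq_forced_notin:
  "forcing_seq G F fs \<Longrightarrow> snd ` set fs \<inter> F = {}"
  by (induction G F fs rule: forcing_seq.induct) (auto simp: forces_def)

lemma forcing_seq_dominates:
  "forcing_seq G F fs \<Longrightarrow> (v, u) \<in> set fs \<Longrightarrow> v \<rightarrow>\<^bsub>G\<^esub> u"
  by (induction G F fs rule: forcing_seq.induct) (auto simp: forces_def)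

text \<open>The first forcing vertex is filled from the start, so no later force reaches it and the
  first force closes no cycle. Acyclicity of the finite set of forces lets chains be followed in
  both directions by well-founded induction.\<close>

lemma forcing_seq_acyclic:
  "forcing_seq G F fs \<Longrightarrow> acyclic (set fs)"
proof (induction G F fs rule: forcing_seq.induct)
  case (2 G F v u fs)
  have "v \<notin> snd ` set fs"
    using 2 forcing_seq_forced_notin[of G "insert u F" fs] by (auto simp: forces_def)
  moreover have "u \<noteq> v" using 2 by (auto simp: forces_def)
  ultimately have "(u, v) \<notin> (set fs)\<^sup>*"
    by (metis rtranclE image_eqI snd_conv)
  then show ?case using 2 by (simp add: acyclic_insert)
qed (simp add: acyclic_def)

text \<open>A proper extension of \<open>p\<close> would contain a force into \<open>hd p\<close> or
  a force out of \<open>last p\<close>.\<close>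

lemma forcing_chainI:
  assumes "force_path G fs p" "hd p \<notin> snd ` set fs" "last p \<notin> fst ` set fs"
  shows "forcing_chain G fs p"
  unfolding forcing_chain_def
proof (intro conjI allI impI)
  fix q assume q: "force_path G fs q \<and> sublist p q"
  then obtain a b where ab: "q = a @ p @ b" by (auto simp: sublist_def)
  have "p \<noteq> []" using assms(1) by (simp add: force_path_def)
  have s: "successively (\<lambda>x y. (x, y) \<in> set fs) (a @ p @ b)"
    using q ab by (simp add: force_path_def)
  have "a = []"
  proof (rule ccontr)
    assume "a \<noteq> []"
    then have "(last a, hd p) \<in> set fs"
      using s \<open>p \<noteq> []\<close> by (auto simp: successively_append_iff)
    then show False using assms(2) by force
  qed
  moreover have "b = []"
  proof (rule ccontr)
    assume "b \<noteq> []"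
    then have "(last p, hd b) \<in> set fs"
      using s \<open>p \<noteq> []\<close> by (auto simp: successively_append_iff)
    then show False using assms(3) by force
  qed
  ultimately show "q = p" using ab by simp
qed (rule assms(1))

text \<open>Following forces forward from \<open>x\<close> must stop, and it can stop only at a
  vertex that does not force. \<open>force_path_to\<close> is the mirror image.\<close>

lemma force_path_from:
  assumes "acyclic (set fs)" "\<And>v u. (v, u) \<in> set fs \<Longrightarrow> u \<in> verts G" "x \<in> verts G"
  shows "\<exists>p. force_path G fs p \<and> hd p = x \<and> last p \<notin> fst ` set fs"
proof -
  have "wf ((set fs)\<inverse>)" using assms(1) by (simp add: finite_acyclic_wf_converse)
  then show ?thesis using assms(3)
  proof (induction x rule: wf_induct_rule)
    case (less x)
    show ?case
    proof (cases "x \<in> fst ` set fs")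
      case True
      then obtain y where y: "(x, y) \<in> set fs" by auto
      then obtain p where "force_path G fs p" "hd p = y" "last p \<notin> fst ` set fs"
        using less assms(2) by blast
      then show ?thesis using y less.prems
        by (intro exI[of _ "x # p"]) (auto simp: force_path_def successively_Cons)
    next
      case False
      then show ?thesis using less.prems
        by (intro exI[of _ "[x]"]) (simp add: force_path_def)
    qed
  qed
qed

lemma force_path_to:
  assumes "acyclic (set fs)" "\<And>v u. (v, u) \<in> set fs \<Longrightarrow> v \<in> verts G" "x \<in> verts G"
  shows "\<exists>p. force_path G fs p \<and> last p = x \<and> hd p \<notin> snd ` set fs"
proof -
  have "wf (set fs)" using assms(1) by (simp add: finite_acyclic_wf)
  then show ?thesis using assms(3)
  proof (induction x rule: wf_induct_rule)
    case (less x)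
    show ?case
    proof (cases "x \<in> snd ` set fs")
      case True
      then obtain y where y: "(y, x) \<in> set fs" by auto
      then obtain p where "force_path G fs p" "last p = y" "hd p \<notin> snd ` set fs"
        using less assms(2) by blast
      then show ?thesis using y less.prems
        by (intro exI[of _ "p @ [x]"]) (auto simp: force_path_def successively_append_iff)
    next
      case False
      then show ?thesis using less.prems
        by (intro exI[of _ "[x]"]) (simp add: force_path_def)
    qed
  qed
qed

text \<open>The last assumption says that \<open>z\<close> takes part in exactly one of the two
  roles. A path followed from \<open>z\<close> in the direction of that role cannot be prolonged at
  \<open>z\<close> either, so it is a chain.\<close>

lemma source_or_terminal:
  assumes "wf_digraph G" "forcing_seq G F fs" "z \<in> verts G"
    and "z \<in> fst ` set fs \<longleftrightarrow> z \<notin> snd ` set fs"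
  shows "source_vertex G fs z \<or> terminal_vertex G fs z"
proof -
  interpret wf_digraph G by fact
  have ac: "acyclic (set fs)" using assms(2) by (rule forcing_seq_acyclic)
  have vs: "v \<in> verts G" "u \<in> verts G" if "(v, u) \<in> set fs" for v u
    using forcing_seq_dominates[OF assms(2) that] by (auto dest: adj_in_verts)
  have long: "length p \<ge> 2" if "force_path G fs p" "hd p \<noteq> last p" for p
    using that by (cases p rule: remdups_adj.cases) (auto simp: force_path_def)
  show ?thesis
  proof (cases "z \<in> snd ` set fs")
    case True
    obtain p where p: "force_path G fs p" "last p = z" "hd p \<notin> snd ` set fs"
      using force_path_to[OF ac _ assms(3)] vs by blast
    then have "forcing_chain G fs p" using True assms(4) by (intro forcing_chainI) auto
    \<comment> \<open>Since \<open>z\<close> is forced and \<open>hd p\<close> is not, the two ends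
      differ and the path is not a single vertex.\<close>
    moreover have "length p \<ge> 2" using p True by (intro long) metis+
    ultimately show ?thesis using p(2) by (auto simp: terminal_vertex_def)
  next
    case False
    obtain p where p: "force_path G fs p" "hd p = z" "last p \<notin> fst ` set fs"
      using force_path_from[OF ac _ assms(3)] vs by blast
    then have "forcing_chain G fs p" using False by (intro forcing_chainI) auto
    moreover have "length p \<ge> 2" using p False assms(4) by (intro long) metis+
    ultimately show ?thesis using p(2) by (auto simp: source_vertex_def)
  qed
qed

section \<open>Simplicial vertices\<close>

lemma simplicial_forced_not_forcing:
  assumes "forcing_seq G F fs" "z \<in> snd ` set fs"
    and "\<And>v w. v \<rightarrow>\<^bsub>G\<^esub> z \<Longrightarrow> z \<rightarrow>\<^bsub>G\<^esub> w \<Longrightarrow> v \<noteq> w \<Longrightarrow> v \<rightarrow>\<^bsub>G\<^esub> w"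
  shows "z \<notin> fst ` set fs"
  using assms
proof (induction G F fs rule: forcing_seq.induct)
  case (2 G F v u fs)
  note simplicial = "2.prems"(3)
  have f: "forces G F v u" and fs: "forcing_seq G (insert u F) fs" using 2 by auto
  show ?case
  proof (cases "u = z")
    case True
    \<comment> \<open>Each neighbor of \<open>z\<close> other than \<open>v\<close> is also a
      neighbor of \<open>v\<close>, whose only unfilled neighbor is \<open>z\<close>.\<close>
    have "{w. z \<rightarrow>\<^bsub>G\<^esub> w} \<subseteq> insert u F"
      using simplicial[of v] f True by (auto simp: forces_def)
    then have "z \<notin> fst ` set fs"
      using fs True by (intro forcing_seq_exhausted) auto
    then show ?thesis using f True by (auto simp: forces_def)
  next
    case False
    then have z: "z \<in> snd ` set fs" using 2 by auto
    \<comment> \<open>A vertex still to be forced is unfilled now, hence cannot perform the current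
      force.\<close>
    then have "z \<notin> F" using forcing_seq_forced_notin[OF fs] by blast
    then have "z \<noteq> v" using f by (auto simp: forces_def)
    moreover have "z \<notin> fst ` set fs" using "2.IH"[OF fs z] simplicial by blast
    ultimately show ?thesis by auto
  qed
qed simp

lemma (in graph) clique_degree_simplicial:
  assumes "clique G T" "z \<in> T" "out_degree G z = card T - 1"
  shows "\<And>v w. v \<rightarrow>\<^bsub>G\<^esub> z \<Longrightarrow> z \<rightarrow>\<^bsub>G\<^esub> w \<Longrightarrow> v \<noteq> w \<Longrightarrow> v \<rightarrow>\<^bsub>G\<^esub> w"
proof -
  let ?N = "head G ` out_arcs G z"
  have N: "z \<rightarrow>\<^bsub>G\<^esub> w \<longleftrightarrow> w \<in> ?N" for w
    by (auto simp: arcs_ends_conv)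
  have "T - {z} \<subseteq> ?N"
  proof
    fix w assume "w \<in> T - {z}"
    then have "z \<rightarrow>\<^bsub>G\<^esub> w" using assms(1,2) by (auto simp: clique_def)
    then show "w \<in> ?N" by (simp only: N)
  qed
  \<comment> \<open>The degree bounds the number of neighbors from above; together with the
    inclusion this makes the neighborhood exactly \<open>T - {z}\<close>.\<close>
  moreover have "card ?N \<le> card (T - {z})"
    using card_image_le[OF finite_out_arcs, of "head G" z] assms(2,3)
    by (simp add: out_degree_def)
  ultimately have eq: "T - {z} = ?N"
    by (intro card_seteq finite_imageI finite_out_arcs)
  have sym: "v \<rightarrow>\<^bsub>G\<^esub> z \<Longrightarrow> z \<rightarrow>\<^bsub>G\<^esub> v" for v
    using arcs_ends_symmetric[OF sym_arcs] by blast
  show "v \<rightarrow>\<^bsub>G\<^esub> w" if "v \<rightarrow>\<^bsub>G\<^esub> z" "z \<rightarrow>\<^bsub>G\<^esub> w" "v \<noteq> w" for v w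
  proof -
    have "w \<in> T - {z}" "v \<in> T - {z}" using that(2) sym[OF that(1)] by (simp_all only: N eq)
    then show ?thesis using assms(1) \<open>v \<noteq> w\<close> by (simp add: clique_def)
  qed
qed

section \<open>Deleting a vertex\<close>

lemma dominates_del_vert:
  "u \<rightarrow>\<^bsub>pre_digraph.del_vert G z\<^esub> v \<longleftrightarrow> u \<rightarrow>\<^bsub>G\<^esub> v \<and> u \<noteq> z \<and> v \<noteq> z"
  by (auto simp: arcs_ends_conv pre_digraph.del_vert_def)

lemma verts_del_vert: "verts (pre_digraph.del_vert G z) = verts G - {z}"
  by (simp add: pre_digraph.del_vert_def)

text \<open>Once \<open>z\<close> is filled it is nobody's unfilled neighbor, so every other vertex
  has the same unfilled neighbors with \<open>z\<close> as without it.\<close>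

lemma forcing_seq_add_vert:
  "forcing_seq (pre_digraph.del_vert G z) F fs \<Longrightarrow> forcing_seq G (insert z F) fs"
proof (induction fs arbitrary: F)
  case (Cons f fs)
  obtain v u where f: "f = (v, u)" by force
  have "forces (pre_digraph.del_vert G z) F v u" using Cons f by simp
  then have "forces G (insert z F) v u"
    unfolding forces_def dominates_del_vert by (auto simp: set_eq_iff)
  moreover have "forcing_seq G (insert z (insert u F)) fs" using Cons f by auto
  ultimately show ?case by (simp add: f insert_commute)
qed simp

lemma zero_forcing_set_add_vert:
  assumes "zero_forcing_set (pre_digraph.del_vert G z) B" "z \<in> verts G"
  shows "zero_forcing_set G (insert z B)"
proof -
  obtain fs where "forcing_seq (pre_digraph.del_vert G z) B fs" "filled_after B fs = verts G - {z}"
    using assms by (auto simp: zero_forcing_set_def verts_del_vert)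
  then show ?thesis
    using assms forcing_seq_add_vert[of G z B fs]
    by (auto simp: zero_forcing_set_def verts_del_vert filled_after_def intro!: exI[of _ fs])
qed

text \<open>
  Forces by \<open>z\<close>, forces onto \<open>z\<close> and forces onto filled vertices are dropped.
\<close>

lemma forcing_seq_del_vert:
  assumes "forcing_seq G F fs" "F - {z} \<subseteq> F'" "\<And>u. (z, u) \<in> set fs \<Longrightarrow> u \<in> F'"
  shows "\<exists>fs'. forcing_seq (pre_digraph.del_vert G z) F' fs' \<and>
    filled_after F' fs' = F' \<union> (snd ` set fs - {z})"
  using assms
proof (induction fs arbitrary: F F')
  case Nil
  show ?case by (intro exI[of _ "[]"]) (simp add: filled_after_def)
next
  case (Cons f fs)
  obtain v u where f: "f = (v, u)" by force
  have force: "forces G F v u" and fs: "forcing_seq G (insert u F) fs" using Cons f by auto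
  show ?case
  proof (cases "u = z \<or> u \<in> F'")
    case True
    then have "insert u F - {z} \<subseteq> F'" using Cons.prems by auto
    moreover have "F' \<union> (snd ` set (f # fs) - {z}) = F' \<union> (snd ` set fs - {z})"
      using True f by auto
    ultimately show ?thesis using Cons.IH[OF fs] Cons.prems(3) by simp
  next
    case False
    then have "v \<noteq> z" using Cons.prems(3) f by auto
    \<comment> \<open>Away from \<open>z\<close>, \<open>F'\<close> contains \<open>F\<close>, so
      \<open>v\<close> has no unfilled neighbor besides \<open>u\<close>, which is still unfilled in
      this case.\<close>
    then have "forces (pre_digraph.del_vert G z) F' v u"
      using force Cons.prems(2) False unfolding forces_def dominates_del_vert
      by (auto simp: set_eq_iff)
    moreover have "\<exists>fs'. forcing_seq (pre_digraph.del_vert G z) (insert u F') fs' \<and>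
        filled_after (insert u F') fs' = insert u F' \<union> (snd ` set fs - {z})"
      using Cons.prems by (intro Cons.IH[OF fs]) auto
    then obtain fs' where "forcing_seq (pre_digraph.del_vert G z) (insert u F') fs'"
      "filled_after (insert u F') fs' = insert u F' \<union> (snd ` set fs - {z})" by blast
    ultimately show ?thesis using False f
      by (intro exI[of _ "(v, u) # fs'"]) (auto simp: filled_after_def)
  qed
qed

lemma zero_forcing_set_del_vert:
  assumes "fin_digraph G" "zero_forcing_set G B" "z \<in> verts G"
    and simplicial: "\<And>v w. v \<rightarrow>\<^bsub>G\<^esub> z \<Longrightarrow> z \<rightarrow>\<^bsub>G\<^esub> w \<Longrightarrow> v \<noteq> w \<Longrightarrow> v \<rightarrow>\<^bsub>G\<^esub> w"
  shows "\<exists>B'. zero_forcing_set (pre_digraph.del_vert G z) B' \<and> card B' \<le> card B"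
proof -
  interpret fin_digraph G by fact
  obtain fs where fs: "forcing_seq G B fs" "filled_after B fs = verts G" and B: "B \<subseteq> verts G"
    using assms(2) by (auto simp: zero_forcing_set_def)
  \<comment> \<open>\<open>U\<close> has at most one element; as a set it treats a forcing and a
    non-forcing \<open>z\<close> uniformly.\<close>
  define U where "U = {u. (z, u) \<in> set fs}"
  define B' where "B' = B - {z} \<union> U"
  have "finite B" using B finite_verts by (rule finite_subset)
  have "z \<notin> U" using forcing_seq_acyclic[OF fs(1)] by (auto simp: U_def acyclic_def)
  have U_sub: "U \<subseteq> snd ` set fs" by (force simp: U_def)
  have "\<exists>fs'. forcing_seq (pre_digraph.del_vert G z) B' fs' \<and>
      filled_after B' fs' = B' \<union> (snd ` set fs - {z})"
    by (rule forcing_seq_del_vert[OF fs(1)]) (auto simp: B'_def U_def)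
  moreover have "B' \<union> (snd ` set fs - {z}) = verts G - {z}"
    using fs(2) U_sub \<open>z \<notin> U\<close> by (auto simp: B'_def filled_after_def)
  ultimately have "zero_forcing_set (pre_digraph.del_vert G z) B'"
    unfolding zero_forcing_set_def verts_del_vert by (metis Un_upper1)
  moreover have "card B' \<le> card B"
  proof (cases "z \<in> B")
    case True
    have "u = u'" if "u \<in> U" "u' \<in> U" for u u'
      using that forcing_seq_forces_once[OF fs(1)] unfolding U_def
      by (auto dest: eq_key_imp_eq_value)
    then have "card U \<le> 1"
      \<comment> \<open>The possible new element of \<open>B'\<close> is paid for by the removal of
        \<open>z\<close>.\<close>
      using finite_subset[OF U_sub] by (simp add: card_le_Suc0_iff_eq)
    then have "card B' \<le> card (B - {z}) + 1"
      unfolding B'_def using card_Un_le[of "B - {z}" U] by linarith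
    also have "\<dots> = card B" using True \<open>finite B\<close> by (metis Suc_eq_plus1 card_Suc_Diff1)
    finally show ?thesis .
  next
    case False
    then have "z \<in> snd ` set fs" using fs(2) assms(3) by (auto simp: filled_after_def)
    then have "z \<notin> fst ` set fs"
      using simplicial_forced_not_forcing[OF fs(1)] simplicial by blast
    \<comment> \<open>Nothing is removed from \<open>B\<close> here, so nothing may be added: a
      forced simplicial \<open>z\<close> does not force.\<close>
    then have "U = {}" by (force simp: U_def)
    then show ?thesis using False by (simp add: B'_def)
  qed
  ultimately show ?thesis by blast
qed

section \<open>The zero forcing number\<close>

lemma zero_forcing_number_le: "zero_forcing_set G B \<Longrightarrow> zero_forcing_number G \<le> card B"
  unfolding zero_forcing_number_def by (rule Least_le) blast

lemma optimal_zero_forcing_set_ex: "\<exists>B. optimal_zero_forcing_set G B"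
  unfolding optimal_zero_forcing_set_def zero_forcing_number_def
  by (rule LeastI_ex) (use zero_forcing_set_verts in blast)

lemma zero_forcing_number_le_del_vert:
  assumes "z \<in> verts G"
  shows "zero_forcing_number G \<le> zero_forcing_number (pre_digraph.del_vert G z) + 1"
proof -
  obtain B where B: "zero_forcing_set (pre_digraph.del_vert G z) B"
    "card B = zero_forcing_number (pre_digraph.del_vert G z)"
    using optimal_zero_forcing_set_ex unfolding optimal_zero_forcing_set_def by blast
  have "zero_forcing_number G \<le> card (insert z B)"
    using zero_forcing_set_add_vert[OF B(1) assms] by (rule zero_forcing_number_le)
  also have "\<dots> \<le> card B + 1" using card_insert_le_m1[of "card B + 1" B z] by simp
  finally show ?thesis using B(2) by simp
qed

theorem theorem5p5:
  fixes G :: "('a, 'b) pre_digraph" and T :: "'a set" and z :: 'a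
  assumes "graph G"
    and "clique G T"
    and "z \<in> T"
    and "out_degree G z = card T - 1"
  shows "(critical_vertex G z \<or> uncritical_vertex G z) \<and>
    int (zero_forcing_number (pre_digraph.del_vert G z))
      \<in> {int (zero_forcing_number G), int (zero_forcing_number G) - 1}"
proof -
  interpret graph G by fact
  have z: "z \<in> verts G" using assms(2,3) by (auto simp: clique_def)
  have simplicial: "\<And>v w. v \<rightarrow>\<^bsub>G\<^esub> z \<Longrightarrow> z \<rightarrow>\<^bsub>G\<^esub> w \<Longrightarrow> v \<noteq> w \<Longrightarrow> v \<rightarrow>\<^bsub>G\<^esub> w"
    using clique_degree_simplicial assms(2-4) by blast
  have "uncritical_vertex G z" if "\<not> critical_vertex G z"
    unfolding uncritical_vertex_def
  proof (intro conjI allI impI z)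
    fix B fs assume opt: "optimal_forcing_seq G B fs"
    then have fs: "forcing_seq G B fs" by (simp add: optimal_forcing_seq_def)
    \<comment> \<open>Being passive in even one optimal sequence would make \<open>z\<close>
      critical.\<close>
    have "z \<in> fst ` set fs \<or> z \<in> snd ` set fs"
      using that opt z unfolding critical_vertex_def by blast
    moreover have "z \<notin> fst ` set fs" if "z \<in> snd ` set fs"
      using simplicial_forced_not_forcing[OF fs that] simplicial by blast
    ultimately show "source_vertex G fs z \<or> terminal_vertex G fs z"
      using source_or_terminal[OF wf_digraph_axioms fs z] by blast
  qed
  moreover have "zero_forcing_number (pre_digraph.del_vert G z) \<le> zero_forcing_number G"
  proof -
    obtain B where B: "zero_forcing_set G B" "card B = zero_forcing_number G"
      using optimal_zero_forcing_set_ex unfolding optimal_zero_forcing_set_def by blast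
    obtain B' where "zero_forcing_set (pre_digraph.del_vert G z) B'" "card B' \<le> card B"
      using zero_forcing_set_del_vert[OF fin_digraph_axioms B(1) z] simplicial by blast
    then show ?thesis using zero_forcing_number_le B(2) by force
  qed
  moreover have "zero_forcing_number G \<le> zero_forcing_number (pre_digraph.del_vert G z) + 1"
    using z by (rule zero_forcing_number_le_del_vert)
  \<comment> \<open>The two bounds leave only two values; \<open>int\<close> keeps the subtraction
    from truncating at zero.\<close>
  ultimately show ?thesis by auto
qed

end
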